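(* Let $D$ be a connected oriented graph such that $H_\omega(D)$ has exactly two distinct eigenvalues $r$ and $s$ with $r>s$. If $s>-2$, then $D$ is isomorphic either to a single directed edge (one arc on two vertices) or to the oriented graph with vertices $u,v,w,x,y,z$ and arcs $u\to x$, $x\to v$, $v\to z$, $z\to u$, $u\to y$, $v\to y$, $w\to z$, $w\to x$, $y\to w$ (an orientation of $K_{3,3}$).
   Context: An oriented graph $D=(V,A)$ is a loopless directed graph in which for each pair of distinct vertices $u,v$ at most one of $(u,v),(v,u)$ is an arc; write $u\to v$ if $(u,v)\in A$. Its underlying graph is the simple graph with an edge $\{u,v\}$ whenever $u\to v$ or $v\to u$; $D$ is connected if its underlying graph is. Let $\omega=\frac{1+i\sqrt3}{2}$. The Hermitian adjacency matrix $H_\omega(D)$ has $(u,v)$-entry $\omega$ if $u\to v$, $\overline{\omega}$ if $v\to u$, and $0$ otherwise. *)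

theory Defs
  imports
    "Graph_Theory.Graph_Theory"
    "Jordan_Normal_Form.Spectral_Radius"
begin

locale oriented_graph = pair_digraph D for D :: "'a pair_pre_digraph" +
  assumes antiparallel_free: "(u, v) \<in> parcs D \<Longrightarrow> (v, u) \<notin> parcs D"

definition omega :: complex where
  "omega = (1 + \<i> * complex_of_real (sqrt 3)) / 2"

definition H_omega_entry :: "'a pair_pre_digraph \<Rightarrow> 'a \<Rightarrow> 'a \<Rightarrow> complex" where
  "H_omega_entry D u v =
     (if (u, v) \<in> parcs D then omega
      else if (v, u) \<in> parcs D then cnj omega
      else 0)"

(* Matrices of type mat are indexed by natural numbers, so the rows and columns are labelled
   through an enumeration vs of the vertex set; another enumeration gives a matrix similar
   to this one by a permutation matrix. *)
definition H_omega :: "'a pair_pre_digraph \<Rightarrow> 'a list \<Rightarrow> complex mat" where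
  "H_omega D vs =
     mat (length vs) (length vs) (\<lambda>(i, j). H_omega_entry D (vs ! i) (vs ! j))"

definition single_arc :: "nat pair_pre_digraph" where
  "single_arc = \<lparr>pverts = {0, 1}, parcs = {(0, 1)}\<rparr>"

datatype k33_vertex = Vu | Vv | Vw | Vx | Vy | Vz

definition oriented_K33 :: "k33_vertex pair_pre_digraph" where
  "oriented_K33 =
     \<lparr>pverts = {Vu, Vv, Vw, Vx, Vy, Vz},
      parcs = {(Vu, Vx), (Vx, Vv), (Vv, Vz), (Vz, Vu), (Vu, Vy), (Vv, Vy),
               (Vw, Vz), (Vw, Vx), (Vy, Vw)}\<rparr>"

end

theory Submission
  imports
    Defs
    "Jordan_Normal_Form.Jordan_Normal_Form_Uniqueness"
begin

text \<open>Having two eigenvalues means \<open>H\<^sup>2 = a H + b I\<close> with \<open>a = r + s\<close> and \<open>b = - r s\<close>; so \<open>D\<close> is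
  \<open>b\<close>-regular, and \<open>s > -2\<close> becomes \<open>b < 2 a + 4\<close>. Comparing coefficients of \<open>1\<close> and \<open>\<omega>\<close> in
  the entry of an arc \<open>u \<rightarrow> v\<close> shows that the paths \<open>u \<rightarrow> w \<rightarrow> v\<close> are as many as the vertices \<open>w\<close>
  joined to both \<open>u\<close> and \<open>v\<close> in the same direction, and exceed the paths \<open>v \<rightarrow> w \<rightarrow> u\<close> by \<open>a\<close>.
  Summed over all arcs, the first equality counts the transitive triangles once on one side and
  twice on the other, so there are none. Hence \<open>a \<le> 0\<close>, which forces \<open>a = 0\<close> and \<open>b \<le> 3\<close>, and \<open>D\<close> is
  triangle-free. At distance 2 the three kinds of paths are equally frequent, so the number of
  common neighbours is a multiple of 3. This excludes \<open>b = 2\<close>, and for \<open>b = 3\<close> makes the underlying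
  graph \<open>K\<^sub>3\<^sub>,\<^sub>3\<close> with an essentially unique orientation.\<close>

section \<open>Hermitian matrices with two eigenvalues\<close>

lemma sum_lessThan_strict_upper_eq_0:
  fixes A :: "nat \<Rightarrow> nat \<Rightarrow> 'b::semiring_0"
  assumes "\<And>i j. j \<le> i \<Longrightarrow> i < n \<Longrightarrow> A i j = 0"
  shows "(\<Sum>i<n. \<Sum>j<n. A i j * A j i) = 0"
proof (intro sum.neutral ballI)
  fix i j assume "i \<in> {..<n}" "j \<in> {..<n}"
  then show "A i j * A j i = 0" using assms by (cases "j \<le> i") auto
qed

lemma sum_diag_mult_comm:
  fixes A B :: "'a::comm_semiring_0 mat"
  assumes "A \<in> carrier_mat n n" "B \<in> carrier_mat n n"
  shows "(\<Sum>i<n. (A * B) $$ (i, i)) = (\<Sum>i<n. (B * A) $$ (i, i))"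
proof -
  have "(\<Sum>i<n. (A * B) $$ (i, i)) = (\<Sum>i<n. \<Sum>j<n. A $$ (i, j) * B $$ (j, i))"
    using assms by (auto simp: scalar_prod_def atLeast0LessThan intro!: sum.cong)
  also have "\<dots> = (\<Sum>j<n. \<Sum>i<n. A $$ (i, j) * B $$ (j, i))"
    by (rule sum.swap)
  also have "\<dots> = (\<Sum>i<n. (B * A) $$ (i, i))"
    using assms by (auto simp: scalar_prod_def atLeast0LessThan mult.commute intro!: sum.cong)
  finally show ?thesis .
qed

text \<open>The inner \<open>Q * P\<close> cancels. Keeping the witnesses \<open>P\<close>,
  \<open>Q\<close> fixed lets a product of polynomials in \<open>A\<close> be carried over to the
  triangular matrix.\<close>

lemma similar_mat_wit_mult:
  assumes A: "A \<in> carrier_mat n n"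
    and sim: "similar_mat_wit A B P Q" "similar_mat_wit A' B' P Q"
  shows "similar_mat_wit (A * A') (B * B') P Q"
proof -
  note S = similar_mat_witD2[OF A sim(1)]
  have A': "A' \<in> carrier_mat n n"
    using sim(2) S(6) unfolding similar_mat_wit_def Let_def by auto
  note S' = similar_mat_witD2[OF A' sim(2)]
  have QPX: "Q * (P * X) = X" if "X \<in> carrier_mat n n" for X
    using assoc_mult_mat[OF S(7) S(6) that] that by (simp add: S(2))
  have "A * A' = P * B * Q * (P * B' * Q)" by (subst S(3), subst S'(3)) simp
  also have "\<dots> = P * (B * B') * Q"
    using S(5-7) S'(5) by (simp add: assoc_mult_mat[of _ n n _ n _ n] QPX)
  finally show ?thesis using A A' S S' by (intro similar_mat_witI) auto
qed

text \<open>Similarity invariance of the trace, from its cyclicity applied to the factors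
  \<open>P\<close> and \<open>B * Q\<close>.\<close>

lemma similar_mat_wit_sum_diag:
  fixes A :: "'a::comm_semiring_1 mat"
  assumes A: "A \<in> carrier_mat n n" and sim: "similar_mat_wit A B P Q"
  shows "(\<Sum>i<n. A $$ (i, i)) = (\<Sum>i<n. B $$ (i, i))"
proof -
  note S = similar_mat_witD2[OF A sim]
  have "(\<Sum>i<n. A $$ (i, i)) = (\<Sum>i<n. (P * (B * Q)) $$ (i, i))"
    using S by (simp add: assoc_mult_mat[of _ n n _ n _ n])
  also have "\<dots> = (\<Sum>i<n. (B * Q * P) $$ (i, i))"
    by (rule sum_diag_mult_comm) (use S in auto)
  also have "B * Q * P = B"
    using S by (simp add: assoc_mult_mat[of _ n n _ n _ n])
  finally show ?thesis .
qed

text \<open>The trace of the square of a Hermitian matrix is the sum of the squared moduli of its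
  entries, while the trace of the square of a strictly triangular matrix vanishes.\<close>
lemma hermitian_similar_strict_upper_eq_0:
  fixes N :: "complex mat"
  assumes N: "N \<in> carrier_mat n n"
    and herm: "\<And>i j. i < n \<Longrightarrow> j < n \<Longrightarrow> N $$ (j, i) = cnj (N $$ (i, j))"
    and sim: "similar_mat_wit N M P Q"
    and strict: "\<And>i j. j \<le> i \<Longrightarrow> i < n \<Longrightarrow> M $$ (i, j) = 0"
    and ij: "i < n" "j < n"
  shows "N $$ (i, j) = 0"
proof -
  have M: "M \<in> carrier_mat n n" using similar_mat_witD2[OF N sim] by auto
  have "(\<Sum>i<n. (N * N) $$ (i, i)) = (\<Sum>i<n. (M * M) $$ (i, i))"
    using similar_mat_wit_sum_diag[OF mult_carrier_mat[OF N N] similar_mat_wit_mult[OF N sim sim]] .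
  also have "(\<Sum>i<n. (M * M) $$ (i, i)) = (\<Sum>i<n. \<Sum>j<n. M $$ (i, j) * M $$ (j, i))"
    using M by (auto simp: scalar_prod_def atLeast0LessThan intro!: sum.cong)
  also have "\<dots> = 0"
    by (rule sum_lessThan_strict_upper_eq_0[of n "\<lambda>i j. M $$ (i, j)"]) (use strict in auto)
  finally have tr: "(\<Sum>i<n. (N * N) $$ (i, i)) = 0" .
  have tr': "(\<Sum>i<n. (N * N) $$ (i, i)) = (\<Sum>i<n. \<Sum>j<n. N $$ (i, j) * N $$ (j, i))"
    using N by (auto simp: scalar_prod_def atLeast0LessThan intro!: sum.cong)
  have norms: "(\<Sum>i<n. \<Sum>j<n. N $$ (i, j) * N $$ (j, i))
      = of_real (\<Sum>i<n. \<Sum>j<n. (cmod (N $$ (i, j)))\<^sup>2)"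
    unfolding of_real_sum
  proof (intro sum.cong refl)
    fix i j assume "i \<in> {..<n}" "j \<in> {..<n}"
    then have "N $$ (j, i) = cnj (N $$ (i, j))" by (intro herm) auto
    then show "N $$ (i, j) * N $$ (j, i) = of_real ((cmod (N $$ (i, j)))\<^sup>2)"
      by (simp only: complex_norm_square)
  qed
  have "(\<Sum>i<n. \<Sum>j<n. (cmod (N $$ (i, j)))\<^sup>2) = 0"
    using tr unfolding tr' norms of_real_eq_0_iff .
  then have "\<forall>i<n. (\<Sum>j<n. (cmod (N $$ (i, j)))\<^sup>2) = 0"
    by (subst (asm) sum_nonneg_eq_0_iff) (auto intro!: sum_nonneg)
  then have "(\<Sum>j<n. (cmod (N $$ (i, j)))\<^sup>2) = 0" using ij by blast
  then have "\<forall>j<n. (cmod (N $$ (i, j)))\<^sup>2 = 0"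
    by (subst (asm) sum_nonneg_eq_0_iff) auto
  then show ?thesis using ij by simp
qed

text \<open>Schur triangularisation replaces diagonalisation: with \<open>T\<close> triangular and
  similar to \<open>A\<close>, (T - r)(T - s) is strictly upper triangular. It is similar to (A -
  r)(A - s), which is Hermitian because r and s are real, and which therefore vanishes.\<close>

lemma hermitian_two_eigenvalues_square:
  fixes A :: "complex mat" and r s :: real
  assumes A: "A \<in> carrier_mat n n"
    and herm: "\<And>i j. i < n \<Longrightarrow> j < n \<Longrightarrow> A $$ (j, i) = cnj (A $$ (i, j))"
    and spec: "spectrum A \<subseteq> {of_real r, of_real s}"
    and ij: "i < n" "j < n"
  shows "(\<Sum>k<n. A $$ (i, k) * A $$ (k, j))
    = of_real (r + s) * A $$ (i, j) - (if i = j then of_real (r * s) else 0)"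
proof -
  obtain es where es: "char_poly A = (\<Prod>e\<leftarrow>es. [:- e, 1:])"
    using char_poly_factorized[OF A] by blast
  obtain T P Q where "schur_decomposition A es = (T, P, Q)"
    by (metis prod_cases3)
  from schur_decomposition[OF A es this]
  have sim: "similar_mat_wit A T P Q" and ut: "upper_triangular T" and dT: "diag_mat T = es"
    by auto
  have T: "T \<in> carrier_mat n n" using similar_mat_witD2[OF A sim] by auto
  have T_diag: "T $$ (i, i) \<in> {of_real r, of_real s}" if "i < n" for i
  proof -
    have "T $$ (i, i) \<in> set es" using that T by (auto simp: dT[symmetric] diag_mat_def)
    then have "poly (char_poly A) (T $$ (i, i)) = 0"
      by (auto simp: es poly_prod_list prod_list_zero_iff image_iff)
    then show ?thesis using spec spectrum_root_char_poly[OF A] by auto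
  qed
  \<comment> \<open>\<open>?c X\<close> is (X - r)(X - s); the goal is that it vanishes at
    \<open>A\<close>.\<close>
  let ?c = "\<lambda>X. char_matrix X (of_real r) * char_matrix X (of_real s)"
  have c_entry: "?c X $$ (i, j) = (\<Sum>k<n. X $$ (i, k) * X $$ (k, j)) - of_real (r + s) * X $$ (i, j)
      + (if i = j then of_real (r * s) else 0)"
    if X: "X \<in> carrier_mat n n" and "i < n" "j < n" for X :: "complex mat" and i j
  proof -
    have "?c X $$ (i, j) = (\<Sum>k<n. (X $$ (i, k) - (if i = k then of_real r else 0))
        * (X $$ (k, j) - (if k = j then of_real s else 0)))"
      using that by (auto simp: char_matrix_def scalar_prod_def atLeast0LessThan intro!: sum.cong)
    also have "\<dots> = (\<Sum>k<n. X $$ (i, k) * X $$ (k, j)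
        - (if k = j then X $$ (i, j) * of_real s else 0)
        - (if k = i then of_real r * X $$ (i, j) else 0)
        + (if k = i then (if i = j then of_real (r * s) else 0) else 0))"
      by (intro sum.cong refl) (auto simp: algebra_simps)
    also have "\<dots> = (\<Sum>k<n. X $$ (i, k) * X $$ (k, j))
        - X $$ (i, j) * of_real s - of_real r * X $$ (i, j) + (if i = j then of_real (r * s) else 0)"
      using that by (simp only: sum.distrib sum_subtractf sum.delta finite_lessThan lessThan_iff if_True)
    finally show ?thesis by (simp add: algebra_simps)
  qed
  have "?c A $$ (i, j) = 0"
  proof (rule hermitian_similar_strict_upper_eq_0[of _ n "?c T" P Q])
    show "?c A \<in> carrier_mat n n"
      by (intro mult_carrier_mat[of _ n n] char_matrix_closed A)
    show "?c A $$ (j, i) = cnj (?c A $$ (i, j))" if "i < n" "j < n" for i j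
    proof -
      have "(\<Sum>k<n. A $$ (j, k) * A $$ (k, i)) = cnj (\<Sum>k<n. A $$ (i, k) * A $$ (k, j))"
        unfolding cnj_sum
      proof (intro sum.cong refl)
        fix k assume "k \<in> {..<n}"
        then have "A $$ (j, k) = cnj (A $$ (k, j))" "A $$ (k, i) = cnj (A $$ (i, k))"
          using that by (auto intro: herm)
        then show "A $$ (j, k) * A $$ (k, i) = cnj (A $$ (i, k) * A $$ (k, j))"
          by (simp only: complex_cnj_mult mult.commute)
      qed
      then show ?thesis using that herm[of i j] by (simp add: c_entry[OF A])
    qed
    show "similar_mat_wit (?c A) (?c T) P Q"
      by (rule similar_mat_wit_mult[of _ n])
        (use A sim in \<open>auto intro: similar_mat_wit_char_matrix\<close>)
    show "?c T $$ (i, j) = 0" if "j \<le> i" "i < n" for i j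
    proof -
      have "?c T $$ (i, j) = (\<Sum>k<n. (T $$ (i, k) - (if i = k then of_real r else 0))
          * (T $$ (k, j) - (if k = j then of_real s else 0)))"
        using T that
        by (auto simp: char_matrix_def scalar_prod_def atLeast0LessThan intro!: sum.cong)
      also have "\<dots> = 0"
      proof (intro sum.neutral ballI)
        fix k assume k: "k \<in> {..<n}"
        \<comment> \<open>Each summand has a factor strictly below the diagonal of \<open>T\<close>,
          except for k = i = j, where the diagonal entry is r or s.\<close>
        consider "k < i" | "j < k" | "k = i" "j = i" using \<open>j \<le> i\<close> by linarith
        then show "(T $$ (i, k) - (if i = k then of_real r else 0))
          * (T $$ (k, j) - (if k = j then of_real s else 0)) = 0"
        proof cases
          case 1
          then show ?thesis using upper_triangularD[OF ut, of k i] T that by simp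
        next
          case 2
          then show ?thesis using upper_triangularD[OF ut, of j k] T k by simp
        next
          case 3
          then show ?thesis using T_diag[of i] that by auto
        qed
      qed
      finally show ?thesis .
    qed
  qed (use ij in auto)
  then show ?thesis using c_entry[OF A ij] by (simp add: algebra_simps)
qed

section \<open>Counting walks of length two\<close>

text \<open>\<open>omega\<close> is a primitive sixth root of unity; the possible weights of a walk
  of length two are written in the basis 1, \<open>omega\<close>.\<close>

lemma omega_mult:
  "omega * omega = omega - 1" "omega * cnj omega = 1" "cnj omega * omega = 1"
  "cnj omega * cnj omega = - omega"
proof -
  have "sqrt 3 * sqrt 3 = 3" by simp
  then show "omega * omega = omega - 1" "omega * cnj omega = 1" "cnj omega * omega = 1"
    "cnj omega * cnj omega = - omega"
    by (auto simp: omega_def complex_eq_iff field_simps)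
qed

text \<open>\<open>omega\<close> is not real, so one complex equation splits into two real ones,
  which become counting identities.\<close>

lemma omega_independent:
  fixes x y x' y' :: real
  assumes "of_real x + of_real y * omega = of_real x' + of_real y' * omega"
  shows "x = x'" "y = y'"
  using assms by (auto simp: omega_def complex_eq_iff)

definition nbrs :: "'a pair_pre_digraph \<Rightarrow> 'a \<Rightarrow> 'a set" where
  "nbrs D u = {w \<in> pverts D. (u, w) \<in> parcs D \<or> (w, u) \<in> parcs D}"

text \<open>Together with \<open>mids D u v\<close> and \<open>mids D v u\<close> this splits the
  common neighbours of \<open>u\<close> and \<open>v\<close> by the weight of the walk through them:
  1, \<open>omega - 1\<close> and \<open>- omega\<close> respectively.\<close>

definition agree :: "'a pair_pre_digraph \<Rightarrow> 'a \<Rightarrow> 'a \<Rightarrow> 'a set" where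
  "agree D u v = {w \<in> pverts D. (u, w) \<in> parcs D \<and> (v, w) \<in> parcs D
      \<or> (w, u) \<in> parcs D \<and> (w, v) \<in> parcs D}"

definition mids :: "'a pair_pre_digraph \<Rightarrow> 'a \<Rightarrow> 'a \<Rightarrow> 'a set" where
  "mids D u v = {w \<in> pverts D. (u, w) \<in> parcs D \<and> (w, v) \<in> parcs D}"

context oriented_graph
begin

lemma finite_sets [simp]: "finite (nbrs D u)" "finite (agree D u v)" "finite (mids D u v)"
  using pair_finite_verts by (auto simp: nbrs_def agree_def mids_def)

lemma not_arc_refl [simp]: "(u, u) \<notin> parcs D"
  using antiparallel_free by blast

lemma nbrs_sym: "u \<in> pverts D \<Longrightarrow> v \<in> nbrs D u \<Longrightarrow> u \<in> nbrs D v"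
  by (auto simp: nbrs_def)

lemma nbrs_not_refl [simp]: "u \<notin> nbrs D u"
  by (auto simp: nbrs_def)

lemma nbrs_subset: "nbrs D u \<subseteq> pverts D"
  by (auto simp: nbrs_def)

lemma nbrs_inter: "nbrs D u \<inter> nbrs D v = agree D u v \<union> mids D u v \<union> mids D v u"
  by (auto simp: nbrs_def agree_def mids_def)

lemma card_nbrs_inter:
  "card (nbrs D u \<inter> nbrs D v) = card (agree D u v) + card (mids D u v) + card (mids D v u)"
proof -
  have "agree D u v \<inter> mids D u v = {}" "(agree D u v \<union> mids D u v) \<inter> mids D v u = {}"
    using antiparallel_free by (auto simp: agree_def mids_def)
  then show ?thesis unfolding nbrs_inter by (simp add: card_Un_disjoint)
qed

lemma agree_self: "agree D u u = nbrs D u" and mids_self: "mids D u u = {}"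
  using antiparallel_free by (auto simp: agree_def mids_def nbrs_def)

lemma sum_walks:
  "(\<Sum>w\<in>pverts D. H_omega_entry D u w * H_omega_entry D w v)
    = of_real (real (card (agree D u v)) - card (mids D u v))
      + of_real (real (card (mids D u v)) - card (mids D v u)) * omega"
proof -
  have "(\<Sum>w\<in>pverts D. H_omega_entry D u w * H_omega_entry D w v)
      = (\<Sum>w\<in>pverts D. of_bool (w \<in> agree D u v) + of_bool (w \<in> mids D u v) * (omega - 1)
          - of_bool (w \<in> mids D v u) * omega)"
    by (intro sum.cong refl)
      (auto simp: H_omega_entry_def agree_def mids_def omega_mult dest: antiparallel_free)
  also have "\<dots> = of_nat (card (agree D u v)) + of_nat (card (mids D u v)) * (omega - 1)
          - of_nat (card (mids D v u)) * omega"
  proof -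
    have *: "(\<Sum>w\<in>pverts D. of_bool (w \<in> S) :: complex) = of_nat (card S)"
      if "S \<subseteq> pverts D" for S
      using that pair_finite_verts by (simp add: Int_absorb1)
    have "agree D u v \<subseteq> pverts D" "mids D u v \<subseteq> pverts D" "mids D v u \<subseteq> pverts D"
      by (auto simp: agree_def mids_def)
    then show ?thesis
      by (simp only: sum.distrib sum_subtractf sum_distrib_right[symmetric] *)
  qed
  finally show ?thesis by (simp add: algebra_simps)
qed

text \<open>Induction along a path in the symmetric closure. It turns knowledge of a few
  neighbourhoods into the whole vertex set.\<close>

lemma connected_closed_set:
  assumes "Digraph_Component.connected (with_proj D)"
    and "u \<in> S" "u \<in> pverts D" and closed: "\<And>x. x \<in> S \<Longrightarrow> nbrs D x \<subseteq> S"
  shows "pverts D \<subseteq> S"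
proof
  fix v assume "v \<in> pverts D"
  then have "u \<rightarrow>\<^sup>*\<^bsub>with_proj (mk_symmetric (with_proj D))\<^esub> v"
    using assms by (auto simp: Digraph_Component.connected_def strongly_connected_def)
  then have "(u, v) \<in> (parcs (mk_symmetric (with_proj D)))\<^sup>*"
    by (auto dest: reachable_rtranclI)
  then show "v \<in> S"
  proof induction
    case (step y z)
    then have "z \<in> nbrs D y"
      by (auto simp: parcs_mk_symmetric nbrs_def dest: in_arcsD1 in_arcsD2)
    then show ?case using closed step by auto
  qed (use assms in simp)
qed

text \<open>Every transitive triangle \<open>u \<rightarrow> w \<rightarrow> v\<close>, \<open>u \<rightarrow> v\<close> is counted once by \<open>mids\<close>, through
  its arc \<open>(u, v)\<close>, but twice by \<open>agree\<close>, through its other two arcs.\<close>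
lemma no_transitive_triangle:
  assumes eq: "\<And>u v. (u, v) \<in> parcs D \<Longrightarrow> card (agree D u v) = card (mids D u v)"
    and arc: "(u, v) \<in> parcs D"
  shows "mids D u v = {}"
proof -
  define e :: "'a \<Rightarrow> 'a \<Rightarrow> nat" where "e u v = of_bool ((u, v) \<in> parcs D)" for u v
  let ?V = "pverts D"
  \<comment> \<open>\<open>T\<close> counts the transitive triangles, with \<open>(u, v)\<close> as
    the arc from source to sink and \<open>w\<close> in the middle.\<close>
  define T where "T = (\<Sum>u\<in>?V. \<Sum>v\<in>?V. \<Sum>w\<in>?V. e u v * (e u w * e w v))"
  have mids: "card (mids D u v) = (\<Sum>w\<in>?V. e u w * e w v)" for u v
  proof -
    have "mids D u v = ?V \<inter> {w. (u, w) \<in> parcs D \<and> (w, v) \<in> parcs D}"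
      by (auto simp: mids_def)
    then show ?thesis
      using pair_finite_verts by (simp add: e_def flip: of_bool_conj)
  qed
  have agree: "card (agree D u v) = (\<Sum>w\<in>?V. e u w * e v w + e w u * e w v)" for u v
  proof -
    have "agree D u v = ?V \<inter> {w. (u, w) \<in> parcs D \<and> (v, w) \<in> parcs D
        \<or> (w, u) \<in> parcs D \<and> (w, v) \<in> parcs D}"
      by (auto simp: agree_def)
    then have "card (agree D u v) = (\<Sum>w\<in>?V. of_bool ((u, w) \<in> parcs D \<and> (v, w) \<in> parcs D
        \<or> (w, u) \<in> parcs D \<and> (w, v) \<in> parcs D))"
      using pair_finite_verts by (simp only: sum_of_bool_eq of_nat_id)
    also have "\<dots> = (\<Sum>w\<in>?V. e u w * e v w + e w u * e w v)"
      by (intro sum.cong refl) (auto simp: e_def dest: antiparallel_free)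
    finally show ?thesis .
  qed
  have "T = (\<Sum>u\<in>?V. \<Sum>v\<in>?V. e u v * card (mids D u v))"
    by (simp add: T_def mids sum_distrib_left)
  also have "\<dots> = (\<Sum>u\<in>?V. \<Sum>v\<in>?V. e u v * card (agree D u v))"
    by (intro sum.cong refl) (auto simp: e_def dest: eq)
  also have "\<dots> = (\<Sum>u\<in>?V. \<Sum>v\<in>?V. \<Sum>w\<in>?V. e u v * (e u w * e v w))
      + (\<Sum>u\<in>?V. \<Sum>v\<in>?V. \<Sum>w\<in>?V. e u v * (e w u * e w v))"
    by (simp add: agree sum_distrib_left sum.distrib distrib_left)
  \<comment> \<open>Here \<open>v\<close> is the middle vertex and \<open>w\<close> the sink, so
    exchanging their names gives \<open>T\<close>; in the other sum \<open>w\<close> is the source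
    and \<open>u\<close> the middle vertex.\<close>
  also have "(\<Sum>u\<in>?V. \<Sum>v\<in>?V. \<Sum>w\<in>?V. e u v * (e u w * e v w)) = T"
  proof -
    have "(\<Sum>v\<in>?V. \<Sum>w\<in>?V. e u v * (e u w * e v w))
        = (\<Sum>w\<in>?V. \<Sum>v\<in>?V. e u v * (e u w * e v w))" for u
      by (rule sum.swap)
    then show ?thesis by (simp add: T_def ac_simps)
  qed
  also have "(\<Sum>u\<in>?V. \<Sum>v\<in>?V. \<Sum>w\<in>?V. e u v * (e w u * e w v)) = T"
  proof -
    have "(\<Sum>u\<in>?V. \<Sum>v\<in>?V. \<Sum>w\<in>?V. e u v * (e w u * e w v))
        = (\<Sum>u\<in>?V. \<Sum>w\<in>?V. \<Sum>v\<in>?V. e u v * (e w u * e w v))"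
      by (rule sum.cong[OF refl], rule sum.swap)
    also have "\<dots> = (\<Sum>w\<in>?V. \<Sum>u\<in>?V. \<Sum>v\<in>?V. e u v * (e w u * e w v))"
      by (rule sum.swap)
    also have "\<dots> = (\<Sum>w\<in>?V. \<Sum>v\<in>?V. \<Sum>u\<in>?V. e u v * (e w u * e w v))"
      by (rule sum.cong[OF refl], rule sum.swap)
    also have "\<dots> = T" unfolding T_def by (simp add: ac_simps)
    finally show ?thesis .
  qed
  \<comment> \<open>The chain reads \<open>T = T + T\<close> in the natural numbers.\<close>
  finally have "T = 0" by simp
  then have "e u v * (e u w * e w v) = 0" if "w \<in> ?V" for w
  proof -
    have "\<forall>u\<in>?V. \<forall>v\<in>?V. \<forall>w\<in>?V. e u v * (e u w * e w v) = 0"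
      using \<open>T = 0\<close> pair_finite_verts by (simp add: T_def)
    then show ?thesis using that arc by (blast dest: in_arcsD1 in_arcsD2)
  qed
  then show ?thesis using arc by (auto simp: mids_def e_def)
qed

end

section \<open>Degrees, triangles and common neighbours under the quadratic equation\<close>

locale quadratic_oriented_graph = oriented_graph +
  fixes a b :: real
  assumes conn: "Digraph_Component.connected (with_proj D)"
    and quadratic: "u \<in> pverts D \<Longrightarrow> v \<in> pverts D \<Longrightarrow>
      (\<Sum>w\<in>pverts D. H_omega_entry D u w * H_omega_entry D w v)
        = of_real a * H_omega_entry D u v + (if u = v then of_real b else 0)"
    and b_nonzero: "b \<noteq> 0"
    and b_less: "b < 2 * a + 4"
begin

text \<open>The diagonal of the equation: stepping to a neighbour and back has weight 1.\<close>

lemma card_nbrs: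
  assumes "u \<in> pverts D"
  shows "real (card (nbrs D u)) = b"
proof -
  have "complex_of_real (real (card (nbrs D u))) = of_real b"
    using quadratic[OF assms assms] unfolding sum_walks agree_self mids_self
    by (simp add: H_omega_entry_def)
  then show ?thesis unfolding of_real_eq_iff .
qed

text \<open>The coefficients of 1 and \<open>omega\<close> in an entry where \<open>H\<close> equals
  \<open>omega\<close>.\<close>

lemma arc_walks:
  assumes "(u, v) \<in> parcs D"
  shows "card (agree D u v) = card (mids D u v)"
    and "real (card (mids D u v)) - card (mids D v u) = a"
proof -
  have "u \<in> pverts D" "v \<in> pverts D" "u \<noteq> v"
    using assms by (auto dest: in_arcsD1 in_arcsD2)
  then have *: "of_real (real (card (agree D u v)) - card (mids D u v))
      + of_real (real (card (mids D u v)) - card (mids D v u)) * omega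
      = of_real 0 + of_real a * omega"
    using quadratic[of u v] assms unfolding sum_walks by (simp add: H_omega_entry_def)
  show "card (agree D u v) = card (mids D u v)"
    "real (card (mids D u v)) - card (mids D v u) = a"
    using omega_independent[OF *] by simp_all
qed

text \<open>Both coefficients vanish here, so the three kinds of common neighbours are equally
  many.\<close>

lemma nonadjacent_walks:
  assumes "u \<in> pverts D" "v \<in> pverts D" "u \<noteq> v" "v \<notin> nbrs D u"
  shows "card (agree D u v) = card (mids D u v)" "card (mids D v u) = card (mids D u v)"
proof -
  have *: "of_real (real (card (agree D u v)) - card (mids D u v))
      + of_real (real (card (mids D u v)) - card (mids D v u)) * omega
      = of_real 0 + of_real 0 * omega"
    using quadratic[of u v] assms unfolding sum_walks by (simp add: H_omega_entry_def nbrs_def)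
  show "card (agree D u v) = card (mids D u v)" "card (mids D v u) = card (mids D u v)"
    using omega_independent[OF *] by simp_all
qed

lemma ex_arc: "\<exists>u v. (u, v) \<in> parcs D"
proof -
  obtain u where u: "u \<in> pverts D"
    using conn by (auto simp: Digraph_Component.connected_def strongly_connected_def)
  then have "nbrs D u \<noteq> {}" using card_nbrs b_nonzero by force
  then show ?thesis by (auto simp: nbrs_def)
qed

text \<open>Without transitive triangles, an arc lies in exactly m = -a cyclic triangles. Their
  third vertices and \<open>v\<close> are distinct neighbours of \<open>u\<close>, so m + 1 \<le> b
  < 4 - 2m, which leaves only m = 0.\<close>

lemma a_eq_0: "a = 0"
proof -
  have mids: "mids D u v = {}" if "(u, v) \<in> parcs D" for u v
    using no_transitive_triangle arc_walks(1) that by blast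
  obtain u v where uv: "(u, v) \<in> parcs D" using ex_arc by blast
  then have V: "u \<in> pverts D" "v \<in> pverts D" by (auto dest: in_arcsD1 in_arcsD2)
  have a: "a = - real (card (mids D v u))" using arc_walks(2)[OF uv] mids[OF uv] by simp
  have "insert v (mids D v u) \<subseteq> nbrs D u" "v \<notin> mids D v u"
    using uv V by (auto simp: mids_def nbrs_def)
  then have "card (mids D v u) + 1 \<le> card (nbrs D u)"
    by (metis Suc_eq_plus1 card_insert_disjoint card_mono finite_sets(1,3))
  then have "real (card (mids D v u)) + 1 \<le> b"
    by (simp add: card_nbrs[OF V(1), symmetric])
  then have "real (card (mids D v u)) < 1" using a b_less by linarith
  then show ?thesis using a by simp
qed

lemma triangle_free:
  assumes "u \<in> pverts D" "v \<in> nbrs D u"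
  shows "nbrs D u \<inter> nbrs D v = {}"
proof -
  have *: "card (nbrs D u \<inter> nbrs D v) = 0" if uv: "(u, v) \<in> parcs D" for u v
  proof -
    have "mids D u v = {}"
      using no_transitive_triangle arc_walks(1) uv by blast
    then show ?thesis using arc_walks[OF uv] a_eq_0 by (simp add: card_nbrs_inter)
  qed
  show ?thesis using assms(2) *[of u v] *[of v u] by (auto simp: nbrs_def Int_commute)
qed

text \<open>Triangle-freeness makes \<open>u\<close> and \<open>v\<close> nonadjacent, so the three
  kinds of common neighbours are equally many; \<open>w\<close> shows that this number is
  positive.\<close>

lemma common_nbr:
  assumes w: "w \<in> pverts D" and uv: "u \<in> nbrs D w" "v \<in> nbrs D w" "u \<noteq> v"
  shows "agree D u v \<noteq> {}" "mids D u v \<noteq> {}" "card (nbrs D u \<inter> nbrs D v) \<ge> 3"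
proof -
  have V: "u \<in> pverts D" "v \<in> pverts D" using uv nbrs_subset by auto
  have "v \<notin> nbrs D u" using triangle_free[OF w uv(1)] uv by auto
  note N = nonadjacent_walks[OF V \<open>u \<noteq> v\<close> this]
  have "w \<in> nbrs D u \<inter> nbrs D v" using w uv nbrs_sym by blast
  then have "card (nbrs D u \<inter> nbrs D v) > 0" by (auto simp: card_gt_0_iff)
  then have "card (mids D u v) > 0" using N by (simp add: card_nbrs_inter)
  then show "agree D u v \<noteq> {}" "mids D u v \<noteq> {}" "card (nbrs D u \<inter> nbrs D v) \<ge> 3"
    using N by (auto simp: card_nbrs_inter)
qed

text \<open>With a = 0 the degree is positive and below 4. Degree 2 fails because two neighbours of
  a vertex share at least 3 neighbours.\<close>

lemma degree_cases: "b = 1 \<or> b = 3"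
proof -
  obtain u where u: "u \<in> pverts D" using ex_arc in_arcsD1 by blast
  have "card (nbrs D u) < 4" "card (nbrs D u) \<noteq> 0"
    using card_nbrs[OF u] b_less b_nonzero a_eq_0 by auto
  moreover have "card (nbrs D u) \<noteq> 2"
  proof
    assume 2: "card (nbrs D u) = 2"
    then obtain x y where xy: "x \<in> nbrs D u" "y \<in> nbrs D u" "x \<noteq> y"
      by (auto simp: card_2_iff)
    have "card (nbrs D x \<inter> nbrs D y) \<le> card (nbrs D x)" by (intro card_mono) auto
    moreover have "card (nbrs D x) = 2"
      using card_nbrs[OF u] card_nbrs[of x] 2 xy nbrs_subset by force
    ultimately show False using common_nbr(3)[OF u xy] by simp
  qed
  ultimately have "card (nbrs D u) = 1 \<or> card (nbrs D u) = 3" by linarith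
  then show ?thesis using card_nbrs[OF u] by auto
qed

end

section \<open>The two graphs\<close>

lemma digraph_iso_with_projI:
  assumes "pair_wf_digraph D" "inj_on f (pverts D)" "f ` pverts D = pverts H"
    and "map_prod f f ` parcs D = parcs H"
  shows "digraph_iso (with_proj D) (with_proj H)"
proof -
  interpret pair_wf_digraph D by fact
  let ?h = "\<lparr>iso_verts = f, iso_arcs = map_prod f f, iso_head = snd, iso_tail = fst\<rparr>"
  have "inj_on (map_prod f f) (parcs D)"
  proof (rule inj_on_subset)
    show "inj_on (map_prod f f) (pverts D \<times> pverts D)"
      using assms(2) by (rule map_prod_inj_on[OF _ assms(2)])
  qed (auto dest: in_arcsD1 in_arcsD2)
  then have "pre_digraph.digraph_isomorphism (with_proj D) ?h"
    using assms wf_digraph_axioms by (auto simp: pre_digraph.digraph_isomorphism_def)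
  moreover have "with_proj H = app_iso ?h (with_proj D)"
    using assms by (auto simp: app_iso_def with_proj_def)
  ultimately show ?thesis unfolding digraph_iso_def by blast
qed

context quadratic_oriented_graph
begin

lemma iso_single_arc:
  assumes "b = 1"
  shows "digraph_iso (with_proj D) (with_proj single_arc)"
proof -
  obtain u v where uv: "(u, v) \<in> parcs D" using ex_arc by blast
  then have V: "u \<in> pverts D" "v \<in> pverts D" "u \<noteq> v" by (auto dest: in_arcsD1 in_arcsD2)
  have deg: "card (nbrs D x) = 1" if "x \<in> pverts D" for x
    using card_nbrs[OF that] assms by simp
  have "v \<in> nbrs D u" "u \<in> nbrs D v" using uv V by (auto simp: nbrs_def)
  then have nb: "nbrs D u = {v}" "nbrs D v = {u}"
    using card_1_singletonE[OF deg[OF V(1)]] card_1_singletonE[OF deg[OF V(2)]]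
    by (metis singletonD)+
  have "pverts D \<subseteq> {u, v}"
    by (rule connected_closed_set[OF conn, of u]) (use V nb in auto)
  then have verts: "pverts D = {u, v}" using V by auto
  have arcs: "parcs D = {(u, v)}"
  proof (intro equalityI subrelI)
    fix p q assume pq: "(p, q) \<in> parcs D"
    then have "p \<in> {u, v}" "q \<in> {u, v}" using verts in_arcsD1 in_arcsD2 by blast+
    then show "(p, q) \<in> {(u, v)}" using pq antiparallel_free[OF uv] by auto
  qed (use uv in simp)
  show ?thesis
    by (rule digraph_iso_with_projI[where f = "\<lambda>x. if x = u then 0 else 1"])
      (use V pair_wf_digraph_axioms in \<open>auto simp: verts arcs single_arc_def\<close>)
qed

text \<open>The nine arcs already give each of the six vertices three neighbours. Degree 3 then
  excludes further edges at them, and connectedness excludes further vertices.\<close>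

lemma iso_K33:
  assumes b: "b = 3" and dist: "distinct [u, v, w, x, y, z]"
    and arcs: "{(u, x), (x, v), (v, z), (z, u), (u, y), (v, y), (w, z), (w, x), (y, w)}
      \<subseteq> parcs D"
  shows "digraph_iso (with_proj D) (with_proj oriented_K33)"
proof -
  have V: "{u, v, w, x, y, z} \<subseteq> pverts D" using arcs by (auto dest: in_arcsD1 in_arcsD2)
  have nbrsI: "nbrs D p = {q, q', q''}"
    if "p \<in> pverts D" "{q, q', q''} \<subseteq> nbrs D p" "distinct [q, q', q'']" for p q q' q''
  proof (rule card_subset_eq[symmetric])
    show "card {q, q', q''} = card (nbrs D p)" using card_nbrs[OF that(1)] b that(3) by simp
  qed (use that in auto)
  have nb: "nbrs D u = {x, y, z}" "nbrs D v = {x, y, z}" "nbrs D w = {x, y, z}"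
    "nbrs D x = {u, v, w}" "nbrs D y = {u, v, w}" "nbrs D z = {u, v, w}"
    by (rule nbrsI; use V arcs dist in \<open>auto simp: nbrs_def\<close>)+
  have "pverts D \<subseteq> {u, v, w, x, y, z}"
    by (rule connected_closed_set[OF conn, of u]) (use V nb in auto)
  then have verts: "pverts D = {u, v, w, x, y, z}" using V by auto
  let ?S = "{(u, x), (x, v), (v, z), (z, u), (u, y), (v, y), (w, z), (w, x), (y, w)}"
  have parcs: "parcs D = ?S"
  proof (intro equalityI arcs subrelI)
    fix p q assume pq: "(p, q) \<in> parcs D"
    then have "p \<in> {u, v, w, x, y, z}" and q: "q \<in> nbrs D p"
      using verts by (auto simp: nbrs_def dest: in_arcsD1 in_arcsD2)
    then have "p \<in> {u, v, w} \<and> nbrs D p = {x, y, z} \<or> p \<in> {x, y, z} \<and> nbrs D p = {u, v, w}"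
      using nb by (elim insertE emptyE) simp_all
    then have "(p, q) \<in> {u, v, w} \<times> {x, y, z} \<union> {x, y, z} \<times> {u, v, w}"
      using q by blast
    \<comment> \<open>Every edge between the two sides occurs in \<open>?S\<close> in one direction;
      the reverse direction would give antiparallel arcs.\<close>
    also have "{u, v, w} \<times> {x, y, z} \<union> {x, y, z} \<times> {u, v, w} \<subseteq> ?S \<union> ?S\<inverse>"
      by simp
    finally have "(p, q) \<in> ?S \<or> (q, p) \<in> ?S" by simp
    moreover have "(q, p) \<notin> ?S" using arcs antiparallel_free[OF pq] by (rule contra_subsetD)
    ultimately show "(p, q) \<in> ?S" by (simp only: simp_thms)
  qed
  define f where "f p = (if p = u then Vu else if p = v then Vv else if p = w then Vw
      else if p = x then Vx else if p = y then Vy else Vz)" for p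
  have f: "f u = Vu" "f v = Vv" "f w = Vw" "f x = Vx" "f y = Vy" "f z = Vz"
    using dist by (auto simp: f_def)
  show ?thesis
    by (rule digraph_iso_with_projI[where f = f])
      (use pair_wf_digraph_axioms dist in \<open>auto simp: verts parcs f oriented_K33_def\<close>)
qed

text \<open>Two neighbours of \<open>t\<close> share at least three neighbours and have only three
  each. This is what produces a complete bipartite graph.\<close>

lemma nbrs_eq:
  assumes b: "b = 3" and t: "t \<in> pverts D" "p \<in> nbrs D t" "q \<in> nbrs D t"
  shows "nbrs D p = nbrs D q"
proof (cases "p = q")
  case False
  have "p \<in> pverts D" "q \<in> pverts D" using t nbrs_subset by auto
  then have deg: "card (nbrs D p) = 3" "card (nbrs D q) = 3" using card_nbrs b by simp_all
  have "card (nbrs D p \<inter> nbrs D q) \<ge> 3" using common_nbr(3)[OF t False] .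
  then have "nbrs D p \<inter> nbrs D q = nbrs D p" "nbrs D p \<inter> nbrs D q = nbrs D q"
    using deg by (intro card_seteq; simp)+
  then show ?thesis by simp
qed simp

text \<open>Of the three common neighbours of two vertices on one side, exactly one is joined to both
  in the same direction, and the other two lie on paths in opposite directions.\<close>
lemma iso_K33_of_outdegree_2:
  assumes b: "b = 3" and nb: "nbrs D u = {x, y, z}" and dist: "distinct [x, y, z]"
    and u: "(u, x) \<in> parcs D" "(u, y) \<in> parcs D" "(z, u) \<in> parcs D"
  shows "digraph_iso (with_proj D) (with_proj oriented_K33)"
proof -
  have V: "u \<in> pverts D" "x \<in> pverts D" "y \<in> pverts D" "z \<in> pverts D"
    using u by (auto dest: in_arcsD1 in_arcsD2)
  have deg: "card (nbrs D p) = 3" if "p \<in> pverts D" for p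
    using card_nbrs[OF that] b by simp
  have ux: "u \<in> nbrs D x" using nbrs_sym[OF V(1), of x] nb by simp
  have "card (nbrs D x - {u}) = 2" using deg[OF V(2)] ux by simp
  then obtain v w where vw: "nbrs D x - {u} = {v, w}" "v \<noteq> w" by (auto simp: card_2_iff)
  then have nbx: "nbrs D x = {u, v, w}" and dist': "distinct [u, v, w]" using ux by auto
  have nbv: "nbrs D v = {x, y, z}" and nbw: "nbrs D w = {x, y, z}"
    using nbrs_eq[OF b V(2), of _ u] nbx nb by auto
  have d: "distinct [u, v, w, x, y, z]"
    using dist dist' nb nbv nbw nbrs_not_refl[of u] nbrs_not_refl[of v] nbrs_not_refl[of w] by auto
  \<comment> \<open>\<open>B\<close> is viewed as a 0/1 matrix with rows u, v, w and columns x, y,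
    z. Paths in both directions force any two rows to differ both ways (\<open>mid\<close>), and
    \<open>agr\<close> forces them to coincide somewhere.\<close>
  define B where "B p q \<longleftrightarrow> (p, q) \<in> parcs D" for p q
  have mid: "\<exists>t\<in>{x, y, z}. B p t \<and> \<not> B q t" and agr: "\<exists>t\<in>{x, y, z}. B p t \<longleftrightarrow> B q t"
    if pq': "p \<in> {u, v, w}" "q \<in> {u, v, w}" "p \<noteq> q" for p q
  proof -
    have pq: "p \<in> nbrs D x" "q \<in> nbrs D x" using nbx that by auto
    have nbp: "nbrs D p = {x, y, z}" using nb nbv nbw that by auto
    obtain t where "(p, t) \<in> parcs D" "(t, q) \<in> parcs D" "t \<in> pverts D"
      using common_nbr(2)[OF V(2) pq pq'(3)] by (auto simp: mids_def)
    moreover from this have "t \<in> {x, y, z}" using nbp by (auto simp: nbrs_def)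
    ultimately show "\<exists>t\<in>{x, y, z}. B p t \<and> \<not> B q t"
      unfolding B_def using antiparallel_free by blast
    obtain t where "(p, t) \<in> parcs D \<and> (q, t) \<in> parcs D \<or> (t, p) \<in> parcs D \<and> (t, q) \<in> parcs D"
      "t \<in> pverts D"
      using common_nbr(1)[OF V(2) pq pq'(3)] by (auto simp: agree_def)
    moreover from this have "t \<in> {x, y, z}" using nbp by (auto simp: nbrs_def)
    ultimately show "\<exists>t\<in>{x, y, z}. B p t \<longleftrightarrow> B q t"
      unfolding B_def using antiparallel_free by blast
  qed
  have rev: "B t p" if "p \<in> {u, v, w}" "t \<in> {x, y, z}" "\<not> B p t" for p t
    using that nb nbv nbw unfolding B_def nbrs_def by auto
  have Bu: "B u x" "B u y" "\<not> B u z" using u antiparallel_free by (auto simp: B_def)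
  \<comment> \<open>Row u is (1,1,0). By \<open>mid\<close> and \<open>agr\<close>, rows v and w
    each have a 1 in column z and exactly one further 1; by \<open>mid\<close> these two rows
    differ.\<close>
  have "B v z" "B w z" "\<not> B v x \<or> \<not> B v y" "\<not> B w x \<or> \<not> B w y" "B v x \<or> B v y" "B w x \<or> B w y"
    using mid[of v u] mid[of w u] mid[of u v] mid[of u w] agr[of u v] agr[of u w] Bu dist'
    by auto
  moreover have "B v x \<longleftrightarrow> \<not> B w x"
    using calculation mid[of v w] mid[of w v] dist' by auto
  ultimately consider "B v z" "B w z" "\<not> B v x" "B v y" "B w x" "\<not> B w y"
    | "B v z" "B w z" "B v x" "\<not> B v y" "\<not> B w x" "B w y"
    by blast
  then show ?thesis
  proof cases
    case 1
    show ?thesis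
      by (rule iso_K33[OF b d])
        (use 1 Bu rev[of u z] rev[of v x] rev[of w y] in \<open>auto simp: B_def\<close>)
  next
    case 2
    \<comment> \<open>This is the first case with \<open>v\<close> and \<open>w\<close>
      exchanged.\<close>
    have "distinct [u, w, v, x, y, z]" using d by auto
    from iso_K33[OF b this] show ?thesis
      using 2 Bu rev[of u z] rev[of w x] rev[of v y] by (auto simp: B_def)
  qed
qed

text \<open>A vertex of out-degree 1 has an out-neighbour of out-degree 2.\<close>
lemma iso_oriented_K33:
  assumes b: "b = 3"
  shows "digraph_iso (with_proj D) (with_proj oriented_K33)"
proof -
  have deg: "card (nbrs D p) = 3" if "p \<in> pverts D" for p
    using card_nbrs[OF that] b by simp
  have nbrs3: "\<exists>q q'. nbrs D t = {p, q, q'} \<and> distinct [p, q, q']"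
    if "p \<in> nbrs D t" "t \<in> pverts D" for t p
  proof -
    have "card (nbrs D t - {p}) = 2" using deg that by simp
    then obtain q q' where "nbrs D t - {p} = {q, q'}" "q \<noteq> q'" by (auto simp: card_2_iff)
    then have "nbrs D t = {p, q, q'}" "distinct [p, q, q']" using that by auto
    then show ?thesis by blast
  qed
  obtain u p where up: "(u, p) \<in> parcs D" using ex_arc by blast
  then have V: "u \<in> pverts D" "p \<in> pverts D" by (auto dest: in_arcsD1 in_arcsD2)
  have "u \<in> nbrs D p" "p \<in> nbrs D u" using up V by (auto simp: nbrs_def)
  then obtain v w q q' where
    nbp: "nbrs D p = {u, v, w}" "distinct [u, v, w]" and
    nbu: "nbrs D u = {p, q, q'}" "distinct [p, q, q']"
    using nbrs3 V by metis
  \<comment> \<open>A path from \<open>v\<close> to \<open>u\<close> ends in an arc into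
    \<open>u\<close>, so \<open>u\<close> is not a source; its remaining neighbour \<open>y\<close>
    decides whether the out-degree is 1 or 2.\<close>
  have "mids D v u \<noteq> {}" using common_nbr(2)[OF V(2), of v u] nbp by auto
  then obtain t where t: "t \<in> nbrs D u" "(t, u) \<in> parcs D" by (auto simp: mids_def nbrs_def)
  have "t \<noteq> p" using t up antiparallel_free by blast
  then obtain z y where z: "nbrs D u = {p, y, z}" "distinct [p, y, z]" "(z, u) \<in> parcs D"
  proof (cases "t = q")
    case True
    then show ?thesis using that[of q' q] nbu t by auto
  next
    case False
    then have "t = q'" using t nbu \<open>t \<noteq> p\<close> by auto
    then show ?thesis using that[of q q'] nbu t by auto
  qed
  show ?thesis
  proof (cases "(u, y) \<in> parcs D")
    case True
    then show ?thesis using iso_K33_of_outdegree_2[OF b z(1,2) up _ z(3)] by blast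
  next
    case False
    \<comment> \<open>Now \<open>p\<close> is the only out-neighbour of \<open>u\<close>, so every
      path of length two from \<open>u\<close> to \<open>t\<close> passes through
      \<open>p\<close>.\<close>
    have out: "(p, t) \<in> parcs D" if t: "t \<in> {v, w}" for t
    proof -
      have "mids D u t \<noteq> {}" using common_nbr(2)[OF V(2), of u t] nbp t by auto
      then obtain m where m: "(u, m) \<in> parcs D" "(m, t) \<in> parcs D" "m \<in> nbrs D u"
        by (auto simp: mids_def nbrs_def)
      then have "m = p" using False z antiparallel_free by auto
      then show ?thesis using m by simp
    qed
    have "nbrs D p = {v, w, u}" "distinct [v, w, u]" using nbp by auto
    then show ?thesis
      by (rule iso_K33_of_outdegree_2[OF b]) (use out up in auto)
  qed
qed

end

section \<open>From the spectrum to the quadratic equation\<close>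

lemma cnj_H_omega_entry:
  assumes "oriented_graph D"
  shows "cnj (H_omega_entry D u v) = H_omega_entry D v u"
  using oriented_graph.antiparallel_free[OF assms] by (auto simp: H_omega_entry_def)

text \<open>Since \<open>vs\<close> enumerates the vertices without repetition, the matrix identity
  over indices becomes one over vertices.\<close>

lemma quadratic_oriented_graph_of_spectrum:
  fixes D :: "'a pair_pre_digraph" and vs :: "'a list" and r s :: real
  assumes D: "oriented_graph D"
    and conn: "Digraph_Component.connected (with_proj D)"
    and vs: "distinct vs" "set vs = pverts D"
    and spec: "spectrum (H_omega D vs) = {complex_of_real r, complex_of_real s}"
    and "r > s" "s > -2"
  shows "quadratic_oriented_graph D (r + s) (- (r * s))"
proof -
  interpret oriented_graph D by fact
  let ?n = "length vs" and ?H = "H_omega D vs"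
  have H: "?H \<in> carrier_mat ?n ?n" by (simp add: H_omega_def)
  have square: "(\<Sum>w\<in>pverts D. H_omega_entry D u w * H_omega_entry D w v)
      = of_real (r + s) * H_omega_entry D u v + (if u = v then of_real (- (r * s)) else 0)"
    if uv: "u \<in> pverts D" "v \<in> pverts D" for u v
  proof -
    obtain i j where ij: "i < ?n" "j < ?n" "u = vs ! i" "v = vs ! j"
      using uv unfolding vs(2)[symmetric] in_set_conv_nth by blast
    have "(\<Sum>w\<in>pverts D. H_omega_entry D u w * H_omega_entry D w v)
        = (\<Sum>k<?n. H_omega_entry D u (vs ! k) * H_omega_entry D (vs ! k) v)"
      by (rule sum.reindex_bij_betw[symmetric], rule bij_betw_nth) (use vs in auto)
    also have "\<dots> = (\<Sum>k<?n. ?H $$ (i, k) * ?H $$ (k, j))"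
      using ij by (simp add: H_omega_def)
    also have "\<dots> = of_real (r + s) * ?H $$ (i, j) - (if i = j then of_real (r * s) else 0)"
      by (rule hermitian_two_eigenvalues_square[OF H])
        (use ij spec cnj_H_omega_entry[OF D] in \<open>auto simp: H_omega_def\<close>)
    finally show ?thesis
      using ij nth_eq_iff_index_eq[OF vs(1), of i j] by (simp add: H_omega_def)
  qed
  have "r * s \<noteq> 0"
  proof
    \<comment> \<open>All degrees would be 0 and \<open>?H\<close> the zero matrix, but one of the
      distinct numbers r and s is a nonzero eigenvalue.\<close>
    assume rs: "r * s = 0"
    have "card (nbrs D u) = 0" if "u \<in> pverts D" for u
      using square[OF that that] rs unfolding sum_walks agree_self mids_self
      by (simp add: H_omega_entry_def)
    then have "parcs D = {}"
      by (auto simp: nbrs_def dest: in_arcsD1 in_arcsD2)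
    then have H0: "?H = 0\<^sub>m ?n ?n"
      by (intro eq_matI) (auto simp: H_omega_def H_omega_entry_def)
    obtain l where l: "l \<in> spectrum ?H" "l \<noteq> 0"
      using spec \<open>r > s\<close> by (cases "r = 0") auto
    then obtain x where x: "x \<in> carrier_vec ?n" "x \<noteq> 0\<^sub>v ?n" "?H *\<^sub>v x = l \<cdot>\<^sub>v x"
      using H by (auto simp: spectrum_def eigenvalue_def eigenvector_def)
    moreover have "0\<^sub>m ?n ?n *\<^sub>v x = 0\<^sub>v ?n"
      using x(1) by (intro eq_vecI) auto
    ultimately have "l \<cdot>\<^sub>v x = 0\<^sub>v ?n" unfolding H0 by simp
    then have "x $ i = 0" if "i < ?n" for i
      using that x(1) l(2) by (auto simp: vec_eq_iff)
    then show False using x by (auto simp: vec_eq_iff)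
  qed
  \<comment> \<open>Expanding this product gives the bound b < 2a + 4.\<close>
  moreover have "(r + 2) * (s + 2) > 0" using \<open>r > s\<close> \<open>s > -2\<close> by simp
  then have "- (r * s) < 2 * (r + s) + 4" by (simp add: algebra_simps)
  ultimately show ?thesis
    using D conn square by (simp add: quadratic_oriented_graph_def quadratic_oriented_graph_axioms_def)
qed

theorem theorem2p5:
  fixes D :: "'a pair_pre_digraph" and vs :: "'a list" and r s :: real
  assumes "oriented_graph D"
    and "Digraph_Component.connected (with_proj D)"
    and "distinct vs" and "set vs = pverts D"
    and "spectrum (H_omega D vs) = {complex_of_real r, complex_of_real s}"
    and "r > s"
    and "s > -2"
  shows "digraph_iso (with_proj D) (with_proj single_arc) \<or>
         digraph_iso (with_proj D) (with_proj oriented_K33)"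
proof -
  interpret quadratic_oriented_graph D "r + s" "- (r * s)"
    using assms by (rule quadratic_oriented_graph_of_spectrum)
  show ?thesis using degree_cases iso_single_arc iso_oriented_K33 by blast
qed

end
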